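(* Let $\mathfrak H$ be a Krein space and let $\mathfrak L$, $\mathcal H$ be Hilbert spaces. Let $T$ be a closed symmetric linear relation in $\mathfrak H$, let $(\mathfrak L,\Gamma)$ be an isometric (respectively essentially unitary, respectively unitary) boundary pair for $T^+$ with Weyl family $M_\Gamma$, and let $V$ be a unitary relation from the $\widehat J^\circ_{\mathfrak L}$-space $\mathfrak L^2$ to the $\widehat J^\circ_{\mathcal H}$-space $\mathcal H^2$ with closed $\operatorname{dom}V\supseteq\operatorname{ran}\Gamma$. Put $\Gamma':=V\Gamma$. Then $(\mathcal H,\Gamma')$ is an isometric (respectively essentially unitary, respectively unitary) boundary pair for $T^+$ with the Weyl family $$M_{\Gamma'}(z)=V(M_\Gamma(z)),\quad z\in\mathbb C_*.$$ If moreover $\ker V\subseteq\operatorname{mul}\Gamma$, then $V$ establishes (via $\Gamma\mapsto\Gamma'=V\Gamma$) a 1-1 correspondence between an isometric (respectively essentially unitary, respectively unitary) boundary pair $(\mathfrak L,\Gamma)$ for $T^+$ and an isometric (respectively essentially unitary, respectively unitary) boundary pair $(\mathcal H,\Gamma')$ for $T^+$.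
   Context: Linear relations: a relation from a linear space $X$ to a linear space $Y$ is a linear subset $R\subseteq X\times Y$ (a relation in $X$ if $X=Y$); operators are identified with their graphs. $\operatorname{dom}R,\operatorname{ran}R$ are the domain and range, $\ker R=\{x:(x,0)\in R\}$, $\operatorname{mul}R=\{y:(0,y)\in R\}$, $R^{-1}=\{(y,x):(x,y)\in R\}$, $R(S)=\{y:\exists x\in S,\ (x,y)\in R\}$, $\overline R$ is the closure; $QR=\{(x,w):\exists y,\ (x,y)\in R,(y,w)\in Q\}$. $\mathbb C_*=\mathbb C\setminus\mathbb R$. Krein space: a Hilbert space $(\mathfrak H,\langle\cdot,\cdot\rangle)$ with a fundamental symmetry $J=J^*=J^{-1}$ and indefinite metric $[f,g]=\langle f,Jg\rangle$. The adjoint of a relation $T$ in $\mathfrak H$ is $T^+=\{(g,g')\in\mathfrak H^2:[f',g]=[f,g']\ \forall(f,f')\in T\}$; $T$ is symmetric if $T\subseteq T^+$. $\mathfrak H^2$ carries the fundamental symmetry $\widehat J_{\mathfrak H}=\begin{pmatrix}0&-iJ\\ iJ&0\end{pmatrix}$; for a Hilbert space $\mathfrak L$, $\mathfrak L^2$ carries $\widehat J^\circ_{\mathfrak L}=\begin{pmatrix}0&-iI\\ iI&0\end{pmatrix}$ (similarly $\mathcal H$). For a relation $R$ between two such spaces, from one with fundamental symmetry $j_1$ to one with fundamental symmetry $j_2$, put $R^+=j_1R^*j_2$ ($R^*$ the Hilbert space adjoint) and $R_\#=(R^+)^{-1}$; $R$ is isometric if $R\subseteq R_\#$, unitary if $R=R_\#$,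 essentially unitary if $\overline R=R_\#$. For a closed symmetric relation $T$ in $\mathfrak H$, $(\mathfrak L,\Gamma)$ with $\Gamma\subseteq\mathfrak H^2\times\mathfrak L^2$ is an isometric boundary pair for $T^+$ if $\Gamma$ is isometric and $T=\ker\Gamma_\#$; it is a unitary (essentially unitary) boundary pair for $T^+$ if in addition $\Gamma$ is unitary (essentially unitary). Its Weyl family is $M_\Gamma(z)=\{\widehat l\in\mathfrak L^2:\exists f\in\mathfrak H,\ ((f,zf),\widehat l)\in\Gamma\}$, $z\in\mathbb C_*$. The same definitions apply to $(\mathcal H,\Gamma')$. *)

theory Defs
  imports "HOL-Analysis.Analysis"
begin

section \<open>Complex Hilbert spaces\<close>

text \<open>
  HOL-Analysis has only real inner product spaces.  The inner product below is
  conjugate-linear in its first argument; none of the notions defined afterwards depends on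
  this choice of convention.  The norm (hence the topology) is the one of the underlying
  real normed space, tied to the inner product by the last axiom.
\<close>

class complex_inner = real_normed_vector +
  fixes scaleC :: "complex \<Rightarrow> 'a \<Rightarrow> 'a" (infixr "*\<^sub>C" 75)
    and cinner :: "'a \<Rightarrow> 'a \<Rightarrow> complex"
  assumes scaleC_add_right: "a *\<^sub>C (x + y) = a *\<^sub>C x + a *\<^sub>C y"
    and scaleC_add_left: "(a + b) *\<^sub>C x = a *\<^sub>C x + b *\<^sub>C x"
    and scaleC_scaleC: "a *\<^sub>C (b *\<^sub>C x) = (a * b) *\<^sub>C x"
    and scaleC_one: "1 *\<^sub>C x = x"
    and scaleR_scaleC: "r *\<^sub>R x = complex_of_real r *\<^sub>C x"
    and cinner_commute: "cinner x y = cnj (cinner y x)"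
    and cinner_add_right: "cinner x (y + z) = cinner x y + cinner x z"
    and cinner_scaleC_right: "cinner x (a *\<^sub>C y) = a * cinner x y"
    and cinner_self: "cinner x x = complex_of_real ((norm x)\<^sup>2)"

class chilbert_space = complex_inner + complete_space

text \<open>The orthogonal sum of two Hilbert spaces; its norm is that of the library's product type.\<close>

instantiation prod :: (complex_inner, complex_inner) complex_inner
begin

definition "a *\<^sub>C p = (a *\<^sub>C fst p, a *\<^sub>C snd p)"

definition "cinner p q = cinner (fst p) (fst q) + cinner (snd p) (snd q)"

instance
proof
  fix a b :: complex and r :: real and x y z :: "'a \<times> 'b"
  show "a *\<^sub>C (x + y) = a *\<^sub>C x + a *\<^sub>C y"
    by (simp add: scaleC_prod_def scaleC_add_right)
  show "(a + b) *\<^sub>C x = a *\<^sub>C x + b *\<^sub>C x"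
    by (simp add: scaleC_prod_def scaleC_add_left)
  show "a *\<^sub>C (b *\<^sub>C x) = (a * b) *\<^sub>C x"
    by (simp add: scaleC_prod_def scaleC_scaleC)
  show "1 *\<^sub>C x = x"
    by (simp add: scaleC_prod_def scaleC_one)
  show "r *\<^sub>R x = complex_of_real r *\<^sub>C x"
    by (simp add: scaleC_prod_def scaleR_prod_def scaleR_scaleC)
  show "cinner x y = cnj (cinner y x)"
    unfolding cinner_prod_def complex_cnj_add by (metis cinner_commute)
  show "cinner x (y + z) = cinner x y + cinner x z"
    by (simp add: cinner_prod_def cinner_add_right)
  show "cinner x (a *\<^sub>C y) = a * cinner x y"
    by (simp add: cinner_prod_def scaleC_prod_def cinner_scaleC_right distrib_left)
  show "cinner x x = complex_of_real ((norm x)\<^sup>2)"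
    by (simp add: cinner_prod_def cinner_self norm_prod_def)
qed

end

instance prod :: (chilbert_space, chilbert_space) chilbert_space ..

instantiation complex :: chilbert_space
begin

definition "a *\<^sub>C (x::complex) = a * x"

definition "cinner (x::complex) y = cnj x * y"

instance
proof
  fix x :: complex
  show "cinner x x = complex_of_real ((norm x)\<^sup>2)"
    by (metis cinner_complex_def complex_norm_square mult.commute)
qed (auto simp: scaleC_complex_def cinner_complex_def algebra_simps scaleR_conv_of_real)

end

global_interpretation complex_vector: vector_space "scaleC :: complex \<Rightarrow> 'a \<Rightarrow> 'a::complex_inner"
  by unfold_locales (rule scaleC_add_right scaleC_add_left scaleC_scaleC scaleC_one)+


section \<open>Linear relations\<close>

text \<open>
  Domain, range, inverse and image of a relation are the library's \<^const>\<open>Domain\<close>,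
  \<^const>\<open>Range\<close>, \<^const>\<open>converse\<close> and \<^const>\<open>Image\<close>.  Note that \<^const>\<open>relcomp\<close>
  composes from left to right: the product written QR in operator notation
  (first R, then Q) is \<open>R O Q\<close>.
\<close>

definition linear_relation :: "('a::complex_inner \<times> 'b::complex_inner) set \<Rightarrow> bool" where
  "linear_relation R \<longleftrightarrow> complex_vector.subspace R"

definition rel_ker :: "('a \<times> 'b::zero) set \<Rightarrow> 'a set" where
  "rel_ker R = {x. (x, 0) \<in> R}"

definition rel_mul :: "('a::zero \<times> 'b) set \<Rightarrow> 'b set" where
  "rel_mul R = {y. (0, y) \<in> R}"

definition graph_of :: "('a \<Rightarrow> 'b) \<Rightarrow> ('a \<times> 'b) set" where
  "graph_of f = {(x, f x) |x. True}"

definition hilbert_adjoint ::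
    "('a::complex_inner \<times> 'b::complex_inner) set \<Rightarrow> ('b \<times> 'a) set" where
  "hilbert_adjoint R = {(v, u). \<forall>(x, y)\<in>R. cinner u x = cinner v y}"


section \<open>Krein spaces\<close>

definition fundamental_symmetry :: "('a::complex_inner \<Rightarrow> 'a) \<Rightarrow> bool" where
  "fundamental_symmetry J \<longleftrightarrow>
     bounded_linear J \<and> (\<forall>a x. J (a *\<^sub>C x) = a *\<^sub>C J x) \<and>
     (\<forall>x y. cinner (J x) y = cinner x (J y)) \<and> (\<forall>x. J (J x) = x)"

definition krein_product :: "('a::complex_inner \<Rightarrow> 'a) \<Rightarrow> 'a \<Rightarrow> 'a \<Rightarrow> complex" where
  "krein_product J f g = cinner f (J g)"

definition krein_adjoint :: "('a::complex_inner \<Rightarrow> 'a) \<Rightarrow> ('a \<times> 'a) set \<Rightarrow> ('a \<times> 'a) set" where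
  "krein_adjoint J T =
     {(g, g'). \<forall>(f, f')\<in>T. krein_product J f' g = krein_product J f g'}"

definition symmetric_relation :: "('a::complex_inner \<Rightarrow> 'a) \<Rightarrow> ('a \<times> 'a) set \<Rightarrow> bool" where
  "symmetric_relation J T \<longleftrightarrow> linear_relation T \<and> T \<subseteq> krein_adjoint J T"

text \<open>
  The fundamental symmetry of the square of a Krein space.  For a Hilbert space, where the
  fundamental symmetry is the identity, it is \<open>square_symmetry id\<close>.
\<close>

definition square_symmetry :: "('a::complex_inner \<Rightarrow> 'a) \<Rightarrow> 'a \<times> 'a \<Rightarrow> 'a \<times> 'a" where
  "square_symmetry J = (\<lambda>(f, f'). ((- \<i>) *\<^sub>C J f', \<i> *\<^sub>C J f))"

lemma fundamental_symmetry_id: "fundamental_symmetry (id :: 'a::complex_inner \<Rightarrow> 'a)"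
  by (simp add: fundamental_symmetry_def id_def bounded_linear_ident)

lemma fundamental_symmetry_square:
  assumes "fundamental_symmetry J"
  shows "fundamental_symmetry (square_symmetry J)"
proof -
  have J: "bounded_linear J" "J (a *\<^sub>C x) = a *\<^sub>C J x"
      "cinner (J x) y = cinner x (J y)" "J (J x) = x" for a x y
    using assms by (auto simp: fundamental_symmetry_def)
  have left: "cinner (a *\<^sub>C x) y = cnj a * cinner x y" for a and x y :: 'a
    by (metis cinner_commute cinner_scaleC_right complex_cnj_mult)
  have scaleC: "bounded_linear (\<lambda>x::'a. a *\<^sub>C x)" for a
  proof (rule bounded_linear_intro[where K = "cmod a"])
    fix x y :: 'a and r :: real
    show "a *\<^sub>C (x + y) = a *\<^sub>C x + a *\<^sub>C y" by (rule scaleC_add_right)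
    show "a *\<^sub>C (r *\<^sub>R x) = r *\<^sub>R (a *\<^sub>C x)"
      by (simp add: scaleR_scaleC scaleC_scaleC mult.commute)
    have "complex_of_real ((norm (a *\<^sub>C x))\<^sup>2) = complex_of_real ((norm x * cmod a)\<^sup>2)"
      unfolding cinner_self[symmetric] left cinner_scaleC_right
      by (simp add: cinner_self power_mult_distrib flip: complex_norm_square)
    then show "norm (a *\<^sub>C x) \<le> norm x * cmod a"
      by (metis norm_ge_zero of_real_eq_iff order_refl power2_eq_iff_nonneg zero_le_mult_iff)
  qed
  have "bounded_linear (square_symmetry J)"
    unfolding square_symmetry_def case_prod_beta
    by (intro bounded_linear_Pair bounded_linear_compose[OF scaleC] bounded_linear_compose[OF J(1)]
        bounded_linear_fst bounded_linear_snd)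
  then show ?thesis
    by (auto simp: fundamental_symmetry_def square_symmetry_def scaleC_prod_def cinner_prod_def J
        scaleC_scaleC scaleC_one left cinner_scaleC_right mult.commute
        simp del: complex_vector.scale_minus_left)
qed

text \<open>
  For a relation from a space with fundamental symmetry \<open>j\<^sub>1\<close> to one with
  fundamental symmetry \<open>j\<^sub>2\<close>: the operator product \<open>j\<^sub>1 R\<^sup>* j\<^sub>2\<close> and its inverse.
\<close>

definition rel_adjoint :: "('a::complex_inner \<Rightarrow> 'a) \<Rightarrow> ('b::complex_inner \<Rightarrow> 'b) \<Rightarrow>
    ('a \<times> 'b) set \<Rightarrow> ('b \<times> 'a) set" where
  "rel_adjoint j\<^sub>1 j\<^sub>2 R = graph_of j\<^sub>2 O hilbert_adjoint R O graph_of j\<^sub>1"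

definition rel_sharp :: "('a::complex_inner \<Rightarrow> 'a) \<Rightarrow> ('b::complex_inner \<Rightarrow> 'b) \<Rightarrow>
    ('a \<times> 'b) set \<Rightarrow> ('a \<times> 'b) set" where
  "rel_sharp j\<^sub>1 j\<^sub>2 R = (rel_adjoint j\<^sub>1 j\<^sub>2 R)\<inverse>"

lemma rel_adjoint_eq_krein_adjoint:
  assumes "fundamental_symmetry J"
  shows "rel_adjoint J J T = krein_adjoint J T"
proof -
  have J: "J (J x) = x" "cinner (J x) y = cinner x (J y)" for x y
    using assms by (auto simp: fundamental_symmetry_def)
  have adj: "(g, g') \<in> rel_adjoint J J T \<longleftrightarrow> (J g, J g') \<in> hilbert_adjoint T" for g g'
    by (auto simp: rel_adjoint_def graph_of_def relcomp_unfold J)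
  have "(J g, J g') \<in> hilbert_adjoint T \<longleftrightarrow> (g, g') \<in> krein_adjoint J T" for g g'
    unfolding hilbert_adjoint_def krein_adjoint_def krein_product_def mem_Collect_eq case_prod_conv
    by (metis (mono_tags, lifting) case_prodD case_prodI2 cinner_commute)
  with adj show ?thesis by auto
qed

datatype relation_kind = Isometric | Essentially_Unitary | Unitary

fun has_kind :: "relation_kind \<Rightarrow> ('a::complex_inner \<Rightarrow> 'a) \<Rightarrow> ('b::complex_inner \<Rightarrow> 'b) \<Rightarrow>
    ('a \<times> 'b) set \<Rightarrow> bool" where
  "has_kind Isometric j\<^sub>1 j\<^sub>2 R \<longleftrightarrow> linear_relation R \<and> R \<subseteq> rel_sharp j\<^sub>1 j\<^sub>2 R"
| "has_kind Essentially_Unitary j\<^sub>1 j\<^sub>2 R \<longleftrightarrow> linear_relation R \<and> closure R = rel_sharp j\<^sub>1 j\<^sub>2 R"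
| "has_kind Unitary j\<^sub>1 j\<^sub>2 R \<longleftrightarrow> linear_relation R \<and> R = rel_sharp j\<^sub>1 j\<^sub>2 R"


section \<open>Boundary pairs\<close>

text \<open>
  \<open>boundary_pair \<kappa> J T \<Gamma>\<close>: the relation \<open>\<Gamma>\<close>, from the square of the Krein space given by
  \<open>J\<close> to the square of a Hilbert space, makes up a boundary pair of kind \<open>\<kappa>\<close> for the adjoint
  of \<open>T\<close>.  The Hilbert space of the pair is the type \<open>'l\<close>.
\<close>

definition boundary_pair :: "relation_kind \<Rightarrow> ('h::complex_inner \<Rightarrow> 'h) \<Rightarrow> ('h \<times> 'h) set \<Rightarrow>
    (('h \<times> 'h) \<times> ('l::complex_inner \<times> 'l)) set \<Rightarrow> bool" where
  "boundary_pair \<kappa> J T \<Gamma> \<longleftrightarrow>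
     has_kind Isometric (square_symmetry J) (square_symmetry id) \<Gamma> \<and>
     T = rel_ker (rel_sharp (square_symmetry J) (square_symmetry id) \<Gamma>) \<and>
     has_kind \<kappa> (square_symmetry J) (square_symmetry id) \<Gamma>"

definition weyl_family :: "(('h::complex_inner \<times> 'h) \<times> ('l \<times> 'l)) set \<Rightarrow> complex \<Rightarrow> ('l \<times> 'l) set"
  where "weyl_family \<Gamma> z = {l. \<exists>f. ((f, z *\<^sub>C f), l) \<in> \<Gamma>}"

end

theory Submission
  imports Defs
begin

text \<open>
  For a relation \<open>R\<close> the relation \<open>R\<^sub>#\<close> is its orthogonal companion for an indefinite metric on the
  product space, so \<open>R\<^sub>#\<^sub># = closure R\<close>.  A unitary \<open>V\<close> with closed domain has a closed range,
  namely the orthogonal companion of \<open>rel_mul V\<close>.  An element \<open>(x, z)\<close> of the companion of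
  \<open>\<Gamma> O V\<close> satisfies \<open>z \<bottom> rel_mul V\<close>, hence \<open>(y, z) \<in> V\<close> for some \<open>y\<close>, and then
  \<open>(x, y) \<in> \<Gamma>\<^sub>#\<close>; thus \<open>(\<Gamma> O V)\<^sub># \<subseteq> \<Gamma>\<^sub># O V\<close>.  This settles the unitary case at once.  In the
  essentially unitary case it makes \<open>(\<Gamma> O V)\<^sub>#\<close> isometric, hence contained in
  \<open>(\<Gamma> O V)\<^sub>#\<^sub># = closure (\<Gamma> O V)\<close>.  As the range of \<open>V\<close> is closed, all of this applies to
  \<open>V\<inverse>\<close> as well, and composition with \<open>V\<inverse>\<close> inverts the correspondence.
\<close>

section \<open>Geometry of complex Hilbert spaces\<close>

lemma cinner_add_left: "cinner (x + y) z = cinner x z + cinner y z"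
  by (metis cinner_add_right cinner_commute complex_cnj_add)

lemma cinner_scaleC_left: "cinner (a *\<^sub>C x) y = cnj a * cinner x y"
  by (metis cinner_commute cinner_scaleC_right complex_cnj_mult)

lemma cinner_zero_right [simp]: "cinner x 0 = 0"
  by (metis add_cancel_right_right cinner_add_right)

lemma cinner_zero_left [simp]: "cinner 0 x = 0"
  by (metis add_cancel_right_right cinner_add_left)

lemma cinner_minus_right: "cinner x (- y) = - cinner x y"
  by (metis add.right_inverse add_eq_0_iff cinner_add_right cinner_zero_right)

lemma cinner_minus_left: "cinner (- x) y = - cinner x y"
  by (metis add.right_inverse add_eq_0_iff cinner_add_left cinner_zero_left)

lemma cinner_diff_right: "cinner x (y - z) = cinner x y - cinner x z"
  by (simp add: cinner_add_right cinner_minus_right flip: add_uminus_conv_diff)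

lemma cinner_diff_left: "cinner (x - y) z = cinner x z - cinner y z"
  by (simp add: cinner_add_left cinner_minus_left flip: add_uminus_conv_diff)

lemma cinner_self_eq_0_iff: "cinner x x = 0 \<longleftrightarrow> x = 0"
  by (simp add: cinner_self)

text \<open>The two cross terms are complex conjugates, so they add up to twice a real part.
  Cauchy-Schwarz, the parallelogram law and the norm of a scalar multiple all come from this
  expansion.\<close>

lemma norm_diff_scaleC_squared:
  "(norm (x - a *\<^sub>C y))\<^sup>2 = (norm x)\<^sup>2 - 2 * Re (a * cinner x y) + (cmod a)\<^sup>2 * (norm y)\<^sup>2"
proof -
  have "cinner y x = cnj (cinner x y)"
    by (rule cinner_commute)
  then have "complex_of_real ((norm (x - a *\<^sub>C y))\<^sup>2)
      = of_real ((norm x)\<^sup>2) - (a * cinner x y + cnj (a * cinner x y)) + (a * cnj a) * of_real ((norm y)\<^sup>2)"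
    unfolding cinner_self[symmetric]
    by (simp add: cinner_diff_left cinner_diff_right cinner_scaleC_left cinner_scaleC_right
        algebra_simps)
  also have "\<dots> = of_real ((norm x)\<^sup>2 - 2 * Re (a * cinner x y) + (cmod a)\<^sup>2 * (norm y)\<^sup>2)"
    by (simp only: complex_add_cnj complex_norm_square[symmetric] of_real_add of_real_diff of_real_mult)
  finally show ?thesis
    using of_real_eq_iff by blast
qed

text \<open>The subtracted vector is the orthogonal projection of \<open>x\<close> onto the line
  through \<open>y\<close>. That the left side is nonnegative gives Cauchy-Schwarz; that the norm
  strictly drops when \<open>cinner x y\<close> is nonzero gives orthogonality of
  minimizers.\<close>

lemma norm_diff_projection_squared:
  assumes "y \<noteq> 0"
  shows "(norm (x - (cinner y x / of_real ((norm y)\<^sup>2)) *\<^sub>C y))\<^sup>2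
    = (norm x)\<^sup>2 - (cmod (cinner x y))\<^sup>2 / (norm y)\<^sup>2"
proof -
  define a where "a = cinner y x / of_real ((norm y)\<^sup>2)"
  have a: "a = cnj (cinner x y) / of_real ((norm y)\<^sup>2)"
    unfolding a_def by (metis cinner_commute)
  have "a * cinner x y = of_real ((cmod (cinner x y))\<^sup>2 / (norm y)\<^sup>2)"
    using complex_norm_square[of "cinner x y"] by (simp add: a mult.commute)
  moreover have "cmod a = cmod (cinner x y) / (norm y)\<^sup>2"
    by (simp only: a norm_divide norm_of_real complex_mod_cnj abs_power2)
  then have "(cmod a)\<^sup>2 * (norm y)\<^sup>2 = (cmod (cinner x y))\<^sup>2 / (norm y)\<^sup>2"
    using assms by (simp add: power_divide power2_eq_square)
  ultimately show ?thesis
    unfolding a_def[symmetric] norm_diff_scaleC_squared by simp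
qed

lemma cinner_Cauchy_Schwarz: "cmod (cinner x y) \<le> norm x * norm y"
proof (cases "y = 0")
  case False
  then have "(cmod (cinner x y))\<^sup>2 / (norm y)\<^sup>2 \<le> (norm x)\<^sup>2"
    using norm_diff_projection_squared[OF False, of x] by (metis diff_ge_0_iff_ge zero_le_power2)
  then have "(cmod (cinner x y))\<^sup>2 \<le> (norm x * norm y)\<^sup>2"
    using False by (simp add: divide_le_eq power_mult_distrib)
  then show ?thesis
    by (rule power2_le_imp_le) simp
qed simp

lemma bounded_linear_cinner_right: "bounded_linear (cinner x)"
  by (rule bounded_linear_intro[where K = "norm x"])
    (simp_all add: cinner_add_right scaleR_scaleC cinner_scaleC_right scaleC_complex_def
      cinner_Cauchy_Schwarz mult.commute[of "norm _" "norm x"])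

lemma bounded_linear_cinner_left: "bounded_linear (\<lambda>x. cinner x y)"
  by (rule bounded_linear_intro[where K = "norm y"])
    (simp_all add: cinner_add_left scaleR_scaleC cinner_scaleC_left scaleC_complex_def
      cinner_Cauchy_Schwarz)

section \<open>Orthogonal projection onto a closed subspace\<close>

lemma parallelogram_law:
  fixes x y :: "'a::complex_inner"
  shows "(norm (x + y))\<^sup>2 + (norm (x - y))\<^sup>2 = 2 * (norm x)\<^sup>2 + 2 * (norm y)\<^sup>2"
  using norm_diff_scaleC_squared[of x 1 y] norm_diff_scaleC_squared[of x "-1" y]
  by (simp add: scaleC_one)

text \<open>Were \<open>cinner r d\<close> nonzero, subtracting from \<open>r\<close> its projection
  onto the line through \<open>d\<close> would shorten it, although the subtracted vector lies in
  \<open>D\<close>.\<close>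

lemma minimal_norm_imp_orthogonal:
  assumes "complex_vector.subspace D" "d \<in> D"
    and min: "\<And>e. e \<in> D \<Longrightarrow> norm r \<le> norm (r - e)"
  shows "cinner r d = 0"
proof (rule ccontr)
  assume nz: "cinner r d \<noteq> 0"
  then have d: "d \<noteq> 0"
    by auto
  define a where "a = cinner d r / of_real ((norm d)\<^sup>2)"
  have "(norm (r - a *\<^sub>C d))\<^sup>2 = (norm r)\<^sup>2 - (cmod (cinner r d))\<^sup>2 / (norm d)\<^sup>2"
    unfolding a_def by (rule norm_diff_projection_squared[OF d])
  moreover have "(cmod (cinner r d))\<^sup>2 / (norm d)\<^sup>2 > 0"
    using nz d by simp
  moreover have "(norm r)\<^sup>2 \<le> (norm (r - a *\<^sub>C d))\<^sup>2"
    using min[of "a *\<^sub>C d"] assms(1,2) by (simp add: complex_vector.subspace_scale power_mono)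
  ultimately show False
    by linarith
qed

text \<open>A sequence in \<open>D\<close> minimizing the distance to \<open>x\<close> is Cauchy by
  the parallelogram law; its limit \<open>p\<close> attains the distance, and a minimal
  \<open>x - p\<close> is orthogonal to \<open>D\<close>.\<close>

lemma orthogonal_projection_exists:
  fixes x :: "'a::chilbert_space"
  assumes D: "complex_vector.subspace D" and "closed D"
  obtains p where "p \<in> D" "\<And>d. d \<in> D \<Longrightarrow> cinner (x - p) d = 0"
proof -
  define m where "m = infdist x D"
  have ne: "D \<noteq> {}"
    using complex_vector.subspace_0[OF D] by auto
  have m_le: "m \<le> norm (x - d)" if "d \<in> D" for d
    using infdist_le[OF that, of x] by (simp add: m_def dist_norm)
  have m0: "m \<ge> 0"
    by (simp add: m_def infdist_nonneg)
  have "\<exists>d\<in>D. norm (x - d) < m + 1 / real (Suc n)" for n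
  proof -
    have "(INF d\<in>D. dist x d) < m + 1 / real (Suc n)"
      using ne by (simp add: m_def infdist_def)
    then show ?thesis
      using ne by (subst (asm) cINF_less_iff) (auto simp: dist_norm bdd_below_def intro!: exI[of _ 0])
  qed
  then obtain s where s: "\<And>n. s n \<in> D" "\<And>n. norm (x - s n) < m + 1 / real (Suc n)"
    by metis
  have lim: "(\<lambda>n. norm (x - s n)) \<longlonglongrightarrow> m"
  proof (rule tendsto_sandwich[OF _ _ tendsto_const])
    show "(\<lambda>n. m + 1 / real (Suc n)) \<longlonglongrightarrow> m"
      using tendsto_add[OF tendsto_const[of m] LIMSEQ_inverse_real_of_nat]
      by (simp add: inverse_eq_divide)
    show "\<forall>\<^sub>F n in sequentially. m \<le> norm (x - s n)"
      by (intro always_eventually allI m_le s(1))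
    show "\<forall>\<^sub>F n in sequentially. norm (x - s n) \<le> m + 1 / real (Suc n)"
      by (intro always_eventually allI less_imp_le s(2))
  qed
  have dist_s: "(norm (s i - s k))\<^sup>2 \<le> 2 * (norm (x - s i))\<^sup>2 + 2 * (norm (x - s k))\<^sup>2 - 4 * m\<^sup>2" for i k
  proof -
    \<comment> \<open>The midpoint stays in \<open>D\<close>, so its distance to \<open>x\<close> is
      at least \<open>m\<close>; this bounds the sum term of the parallelogram law from below by
      \<open>4 * m\<^sup>2\<close>.\<close>
    let ?mid = "(1/2) *\<^sub>R (s i + s k)"
    have "?mid \<in> D"
      using s(1) D by (simp add: scaleR_scaleC complex_vector.subspace_add complex_vector.subspace_scale)
    then have "m \<le> norm (x - ?mid)"
      by (rule m_le)
    moreover have "(x - s i) + (x - s k) = 2 *\<^sub>R (x - ?mid)"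
      by (simp add: scaleR_right_diff_distrib scaleR_2)
    ultimately have "4 * m\<^sup>2 \<le> (norm ((x - s i) + (x - s k)))\<^sup>2"
      using m0 by (simp add: power_mult_distrib power_mono)
    moreover have "norm ((x - s i) - (x - s k)) = norm (s i - s k)"
      by (simp add: norm_minus_commute)
    ultimately show ?thesis
      using parallelogram_law[of "x - s i" "x - s k"] by simp
  qed
  have "Cauchy s"
  proof (rule metric_CauchyI)
    fix e :: real assume "e > 0"
    have "(\<lambda>n. (norm (x - s n))\<^sup>2) \<longlonglongrightarrow> m\<^sup>2"
      by (intro tendsto_intros lim)
    \<comment> \<open>The quarter fits \<open>dist_s\<close>: two terms with factor 2 give
      \<open>4 * m\<^sup>2 + e\<^sup>2\<close>, and \<open>4 * m\<^sup>2\<close> cancels.\<close>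
    then have "\<forall>\<^sub>F n in sequentially. (norm (x - s n))\<^sup>2 < m\<^sup>2 + e\<^sup>2 / 4"
      using \<open>e > 0\<close> by (intro order_tendstoD) auto
    then obtain N where N: "\<And>n. n \<ge> N \<Longrightarrow> (norm (x - s n))\<^sup>2 < m\<^sup>2 + e\<^sup>2 / 4"
      by (auto simp: eventually_sequentially)
    have "dist (s i) (s k) < e" if "i \<ge> N" "k \<ge> N" for i k
    proof -
      have "(norm (s i - s k))\<^sup>2 < e\<^sup>2"
        using dist_s[of i k] N[OF that(1)] N[OF that(2)] by linarith
      then show ?thesis
        using \<open>e > 0\<close> by (simp add: dist_norm power_less_imp_less_base)
    qed
    then show "\<exists>N. \<forall>i\<ge>N. \<forall>k\<ge>N. dist (s i) (s k) < e"
      by blast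
  qed
  then obtain p where p: "s \<longlonglongrightarrow> p"
    using Cauchy_convergent convergent_def by blast
  have "p \<in> D"
    using \<open>closed D\<close> p s(1) closed_sequentially by blast
  have "(\<lambda>n. norm (x - s n)) \<longlonglongrightarrow> norm (x - p)"
    by (intro tendsto_intros p)
  then have pm: "norm (x - p) = m"
    using lim LIMSEQ_unique by blast
  show thesis
  proof (rule that[OF \<open>p \<in> D\<close>])
    fix d assume "d \<in> D"
    show "cinner (x - p) d = 0"
    proof (rule minimal_norm_imp_orthogonal[OF D \<open>d \<in> D\<close>])
      fix e assume "e \<in> D"
      then have "p + e \<in> D"
        using \<open>p \<in> D\<close> D by (simp add: complex_vector.subspace_add)
      then show "norm (x - p) \<le> norm (x - p - e)"
        using m_le[of "p + e"] by (simp add: pm diff_diff_add)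
    qed
  qed
qed

text \<open>The uniform boundedness principle for the functionals \<open>cinner f\<close>. The
  closed sets \<open>A n\<close> cover the space, so by Baire some \<open>A n\<close> contains a
  ball; differences of points of that ball bound every \<open>f\<close>.\<close>

lemma weakly_bounded_imp_bounded:
  fixes F :: "'a::chilbert_space set"
  assumes "\<And>y. \<exists>B. \<forall>f\<in>F. cmod (cinner f y) \<le> B"
  shows "bounded F"
proof -
  define A where "A n = {y. \<forall>f\<in>F. cmod (cinner f y) \<le> real n}" for n
  have closed_A: "closed (A n)" for n
  proof -
    have "A n = (\<Inter>f\<in>F. {y. cmod (cinner f y) \<le> real n})"
      by (auto simp: A_def)
    moreover have "closed {y. cmod (cinner f y) \<le> real n}" for f
      by (intro closed_Collect_le continuous_intros
          linear_continuous_on[OF bounded_linear_cinner_right])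
    ultimately show ?thesis
      by auto
  qed
  have cover: "(\<Union>n. A n) = UNIV"
  proof (intro equalityI subset_UNIV subsetI)
    fix y
    obtain B where "\<forall>f\<in>F. cmod (cinner f y) \<le> B"
      using assms by blast
    moreover obtain n where "B \<le> real n"
      using real_arch_simple by blast
    ultimately have "y \<in> A n"
      by (auto simp: A_def)
    then show "y \<in> (\<Union>n. A n)"
      by blast
  qed
  have "\<exists>n. interior (A n) \<noteq> {}"
  proof (rule ccontr)
    assume "\<nexists>n. interior (A n) \<noteq> {}"
    then have "interior (\<Union>n. A n) = {}"
      using Met_TC.metric_Baire_category_alt[where ?'a = 'a, of "range A"] closed_A complete_UNIV
      by auto
    with cover show False
      by simp
  qed
  then obtain n y e where e: "e > 0" "cball y e \<subseteq> A n"
    by (metis ex_in_conv mem_interior_cball)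
  have "norm f \<le> 2 * real n / e" if "f \<in> F" for f
  proof (cases "f = 0")
    case False
    \<comment> \<open>A vector of length \<open>e\<close> in the direction of \<open>f\<close>,
      where \<open>cinner f\<close> attains its norm.\<close>
    define h where "h = (e / norm f) *\<^sub>R f"
    have "norm h = e"
      using False e by (simp add: h_def)
    then have "y \<in> A n" "y + h \<in> A n"
      using e by (auto simp: dist_norm)
    then have "cmod (cinner f h) \<le> 2 * real n"
      using that norm_triangle_ineq4[of "cinner f (y + h)" "cinner f y"]
      by (force simp: A_def cinner_add_right)
    moreover have "cmod (cinner f h) = e * norm f"
      using False e by (simp add: h_def scaleR_scaleC cinner_scaleC_right cinner_self
          norm_mult norm_divide norm_power power2_eq_square)
    ultimately show ?thesis
      using e by (simp add: field_simps)
  qed (use e in simp)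
  then show ?thesis
    by (rule boundedI)
qed

section \<open>Complex scaling and closures of subspaces\<close>

lemma norm_scaleC [simp]: "norm (a *\<^sub>C x) = cmod a * norm x"
proof -
  have "(norm (a *\<^sub>C x))\<^sup>2 = (cmod a * norm x)\<^sup>2"
    using norm_diff_scaleC_squared[of 0 a x] by (simp add: power_mult_distrib)
  then show ?thesis
    by (simp add: power2_eq_iff_nonneg)
qed

lemma bounded_linear_scaleC: "bounded_linear ((*\<^sub>C) a)"
  by (rule bounded_linear_intro[where K = "cmod a"])
    (simp_all add: scaleC_add_right scaleR_scaleC scaleC_scaleC mult.commute)

lemma subspace_closure:
  assumes A: "complex_vector.subspace A"
  shows "complex_vector.subspace (closure A)"
proof (rule complex_vector.subspaceI)
  show "0 \<in> closure A"
    using complex_vector.subspace_0[OF A] closure_subset by blast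
next
  fix x y assume "x \<in> closure A" "y \<in> closure A"
  then obtain f g where "\<And>n. f n \<in> A" "f \<longlonglongrightarrow> x" "\<And>n. g n \<in> A" "g \<longlonglongrightarrow> y"
    by (metis closure_sequential)
  then have "(\<lambda>n. f n + g n) \<longlonglongrightarrow> x + y" "\<And>n. f n + g n \<in> A"
    using A by (auto intro: tendsto_add complex_vector.subspace_add)
  then show "x + y \<in> closure A"
    unfolding closure_sequential by (metis (mono_tags))
next
  fix a x assume "x \<in> closure A"
  then obtain f where "\<And>n. f n \<in> A" "f \<longlonglongrightarrow> x"
    by (metis closure_sequential)
  then have "(\<lambda>n. a *\<^sub>C f n) \<longlonglongrightarrow> a *\<^sub>C x" "\<And>n. a *\<^sub>C f n \<in> A"
    using A by (auto intro: bounded_linear.tendsto[OF bounded_linear_scaleC]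
        complex_vector.subspace_scale)
  then show "a *\<^sub>C x \<in> closure A"
    unfolding closure_sequential by (metis (mono_tags))
qed

section \<open>Orthogonality in Krein spaces\<close>

text \<open>The orthogonal companion for the indefinite metric; moving the self-adjoint
  \<open>j\<close> to the other argument turns the condition into
  \<open>cinner x (j a) = 0\<close>.\<close>

definition krein_orthogonal :: "('a::complex_inner \<Rightarrow> 'a) \<Rightarrow> 'a set \<Rightarrow> 'a set" where
  "krein_orthogonal j A = {x. \<forall>a\<in>A. cinner (j x) a = 0}"

lemma fundamental_symmetryD:
  assumes "fundamental_symmetry j"
  shows "bounded_linear j" "j (a *\<^sub>C x) = a *\<^sub>C j x" "cinner (j x) y = cinner x (j y)" "j (j x) = x"
    "j 0 = 0" "j (x + y) = j x + j y" "j (x - y) = j x - j y"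
  using assms by (auto simp: fundamental_symmetry_def linear_simps)

lemma norm_fundamental_symmetry:
  assumes "fundamental_symmetry j"
  shows "norm (j x) = norm x"
proof -
  have "cinner (j x) (j x) = cinner x x"
    using assms by (simp add: fundamental_symmetryD)
  then have "(norm (j x))\<^sup>2 = (norm x)\<^sup>2"
    unfolding cinner_self of_real_eq_iff .
  then show ?thesis
    by (simp add: power2_eq_iff_nonneg)
qed

lemma krein_orthogonal_commute:
  assumes "fundamental_symmetry j"
  shows "cinner (j x) y = 0 \<longleftrightarrow> cinner (j y) x = 0"
  by (metis assms cinner_commute complex_cnj_zero_iff fundamental_symmetryD(3))

lemma closed_krein_orthogonal:
  assumes "fundamental_symmetry j"
  shows "closed (krein_orthogonal j A)"
proof -
  have "krein_orthogonal j A = (\<Inter>a\<in>A. {x. cinner (j x) a = 0})"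
    by (auto simp: krein_orthogonal_def)
  moreover have "closed {x. cinner (j x) a = 0}" for a
    by (intro closed_Collect_eq continuous_intros linear_continuous_on
        bounded_linear_compose[OF bounded_linear_cinner_left] fundamental_symmetryD(1) assms)
  ultimately show ?thesis
    by auto
qed

text \<open>The Hilbert space argument for double orthogonal complements, with \<open>j\<close>
  carrying the ordinary orthogonal complement onto the indefinite one.\<close>

lemma krein_orthogonal_krein_orthogonal:
  fixes A :: "'a::chilbert_space set"
  assumes j: "fundamental_symmetry j" and A: "complex_vector.subspace A"
  shows "krein_orthogonal j (krein_orthogonal j A) = closure A"
proof
  show "closure A \<subseteq> krein_orthogonal j (krein_orthogonal j A)"
  proof (rule closure_minimal)
    show "A \<subseteq> krein_orthogonal j (krein_orthogonal j A)"
      using krein_orthogonal_commute[OF j] by (auto simp: krein_orthogonal_def)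
  qed (rule closed_krein_orthogonal[OF j])
next
  show "krein_orthogonal j (krein_orthogonal j A) \<subseteq> closure A"
  proof
    fix x assume x: "x \<in> krein_orthogonal j (krein_orthogonal j A)"
    obtain p where p: "p \<in> closure A" "\<And>d. d \<in> closure A \<Longrightarrow> cinner (x - p) d = 0"
      using orthogonal_projection_exists[OF subspace_closure[OF A] closed_closure] by blast
    \<comment> \<open>Testing \<open>x\<close> against this vector cancels both copies of
      \<open>j\<close> and yields \<open>cinner x (x - p) = 0\<close>. As \<open>p\<close> is also
      orthogonal to \<open>x - p\<close>, the latter vanishes.\<close>
    have "j (x - p) \<in> krein_orthogonal j A"
      using p(2) closure_subset[of A] by (auto simp: krein_orthogonal_def fundamental_symmetryD(4)[OF j])
    then have "cinner x (x - p) = 0"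
      using x by (auto simp: krein_orthogonal_def fundamental_symmetryD[OF j])
    moreover have "cinner p (x - p) = 0"
      using p by (metis cinner_commute complex_cnj_zero)
    ultimately have "cinner (x - p) (x - p) = 0"
      by (simp add: cinner_diff_left)
    then show "x \<in> closure A"
      using p(1) by (simp add: cinner_self_eq_0_iff)
  qed
qed

section \<open>Linear relations between Krein spaces\<close>

text \<open>Since \<open>j\<^sub>1\<close> is an involution, the intermediate element in the product
  of relations must be \<open>j\<^sub>1 x\<close>. The result is an abstract Green identity, the
  working form of the companion from here on.\<close>

lemma rel_sharp_iff:
  assumes "fundamental_symmetry j\<^sub>1"
  shows "(x, y) \<in> rel_sharp j\<^sub>1 j\<^sub>2 R \<longleftrightarrow> (\<forall>(u, v)\<in>R. cinner (j\<^sub>1 x) u = cinner (j\<^sub>2 y) v)"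
proof -
  have "(x, y) \<in> rel_sharp j\<^sub>1 j\<^sub>2 R \<longleftrightarrow> (j\<^sub>2 y, j\<^sub>1 x) \<in> hilbert_adjoint R"
    by (force simp: rel_sharp_def rel_adjoint_def graph_of_def relcomp_unfold
        fundamental_symmetryD[OF assms])
  then show ?thesis
    by (auto simp: hilbert_adjoint_def)
qed

text \<open>The minus sign makes orthogonality of \<open>(x, y)\<close> and \<open>(u, v)\<close>
  the equality of the two indefinite products in the Green identity.\<close>

definition product_symmetry ::
    "('a::complex_inner \<Rightarrow> 'a) \<Rightarrow> ('b::complex_inner \<Rightarrow> 'b) \<Rightarrow> 'a \<times> 'b \<Rightarrow> 'a \<times> 'b" where
  "product_symmetry j\<^sub>1 j\<^sub>2 = (\<lambda>(x, y). (j\<^sub>1 x, - j\<^sub>2 y))"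

lemma fundamental_symmetry_product:
  assumes "fundamental_symmetry j\<^sub>1" "fundamental_symmetry j\<^sub>2"
  shows "fundamental_symmetry (product_symmetry j\<^sub>1 j\<^sub>2)"
proof -
  have neg: "j\<^sub>2 (- y) = - j\<^sub>2 y" for y
    using fundamental_symmetryD(5)[OF assms(2)] fundamental_symmetryD(7)[OF assms(2), of 0 y] by simp
  have "bounded_linear (product_symmetry j\<^sub>1 j\<^sub>2)"
    unfolding product_symmetry_def case_prod_beta
    by (intro bounded_linear_Pair bounded_linear_minus
        bounded_linear_compose[OF fundamental_symmetryD(1)[OF assms(1)]]
        bounded_linear_compose[OF fundamental_symmetryD(1)[OF assms(2)]]
        bounded_linear_fst bounded_linear_snd)
  then show ?thesis
    by (auto simp: fundamental_symmetry_def product_symmetry_def cinner_prod_def scaleC_prod_def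
        cinner_minus_left cinner_minus_right neg
        fundamental_symmetryD[OF assms(1)] fundamental_symmetryD[OF assms(2)])
qed

lemma rel_sharp_eq_krein_orthogonal:
  assumes "fundamental_symmetry j\<^sub>1"
  shows "rel_sharp j\<^sub>1 j\<^sub>2 R = krein_orthogonal (product_symmetry j\<^sub>1 j\<^sub>2) R"
proof -
  have "p \<in> rel_sharp j\<^sub>1 j\<^sub>2 R \<longleftrightarrow> p \<in> krein_orthogonal (product_symmetry j\<^sub>1 j\<^sub>2) R" for p
    by (cases p) (simp add: rel_sharp_iff[OF assms] krein_orthogonal_def
        product_symmetry_def cinner_prod_def cinner_minus_left case_prod_beta)
  then show ?thesis
    by blast
qed

lemma closed_rel_sharp:
  assumes "fundamental_symmetry j\<^sub>1" "fundamental_symmetry j\<^sub>2"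
  shows "closed (rel_sharp j\<^sub>1 j\<^sub>2 R)"
  by (simp add: rel_sharp_eq_krein_orthogonal closed_krein_orthogonal fundamental_symmetry_product assms)

lemma rel_sharp_rel_sharp:
  fixes R :: "('a::chilbert_space \<times> 'b::chilbert_space) set"
  assumes "fundamental_symmetry j\<^sub>1" "fundamental_symmetry j\<^sub>2" "linear_relation R"
  shows "rel_sharp j\<^sub>1 j\<^sub>2 (rel_sharp j\<^sub>1 j\<^sub>2 R) = closure R"
  using assms unfolding linear_relation_def
  by (simp add: rel_sharp_eq_krein_orthogonal krein_orthogonal_krein_orthogonal
      fundamental_symmetry_product)

lemma rel_sharp_converse:
  assumes "fundamental_symmetry j\<^sub>1" "fundamental_symmetry j\<^sub>2"
  shows "rel_sharp j\<^sub>2 j\<^sub>1 (R\<inverse>) = (rel_sharp j\<^sub>1 j\<^sub>2 R)\<inverse>"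
  using assms by (force simp: rel_sharp_iff)

text \<open>With second component 0 the Green identity no longer sees \<open>v\<close>, so only the
  first components of \<open>R\<close> matter.\<close>

lemma rel_ker_rel_sharp:
  assumes "fundamental_symmetry j\<^sub>1" "fundamental_symmetry j\<^sub>2"
  shows "rel_ker (rel_sharp j\<^sub>1 j\<^sub>2 R) = krein_orthogonal j\<^sub>1 (Domain R)"
  using assms by (auto simp: rel_ker_def rel_sharp_iff krein_orthogonal_def fundamental_symmetryD(5))

lemma rel_mul_rel_sharp:
  assumes "fundamental_symmetry j\<^sub>1" "fundamental_symmetry j\<^sub>2"
  shows "rel_mul (rel_sharp j\<^sub>1 j\<^sub>2 R) = krein_orthogonal j\<^sub>2 (Range R)"
  using assms by (force simp: rel_mul_def rel_sharp_iff krein_orthogonal_def fundamental_symmetryD(5))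

section \<open>Linear relations as subspaces\<close>

lemma linear_relationD:
  assumes "linear_relation R"
  shows "(0, 0) \<in> R"
    and "(x, y) \<in> R \<Longrightarrow> (u, v) \<in> R \<Longrightarrow> (x + u, y + v) \<in> R"
    and "(x, y) \<in> R \<Longrightarrow> (u, v) \<in> R \<Longrightarrow> (x - u, y - v) \<in> R"
    and "(x, y) \<in> R \<Longrightarrow> (a *\<^sub>C x, a *\<^sub>C y) \<in> R"
  using complex_vector.subspace_0[OF assms[unfolded linear_relation_def]]
    complex_vector.subspace_add[OF assms[unfolded linear_relation_def], of "(x, y)" "(u, v)"]
    complex_vector.subspace_diff[OF assms[unfolded linear_relation_def], of "(x, y)" "(u, v)"]
    complex_vector.subspace_scale[OF assms[unfolded linear_relation_def], of "(x, y)" a]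
  by (auto simp: zero_prod_def scaleC_prod_def)

lemma linear_relationI:
  assumes "(0, 0) \<in> R"
    and "\<And>x y u v. (x, y) \<in> R \<Longrightarrow> (u, v) \<in> R \<Longrightarrow> (x + u, y + v) \<in> R"
    and "\<And>a x y. (x, y) \<in> R \<Longrightarrow> (a *\<^sub>C x, a *\<^sub>C y) \<in> R"
  shows "linear_relation R"
  unfolding linear_relation_def
  by (rule complex_vector.subspaceI) (auto simp: assms zero_prod_def scaleC_prod_def)

lemma linear_relation_converse:
  assumes "linear_relation R"
  shows "linear_relation (R\<inverse>)"
  by (rule linear_relationI) (simp_all add: linear_relationD[OF assms])

lemma linear_relation_relcomp:
  assumes "linear_relation R" "linear_relation Q"
  shows "linear_relation (R O Q)"
proof (rule linear_relationI)
  show "(0, 0) \<in> R O Q"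
    using linear_relationD(1)[OF assms(1)] linear_relationD(1)[OF assms(2)] by (rule relcompI)
qed (use linear_relationD(2,4)[OF assms(1)] linear_relationD(2,4)[OF assms(2)] in \<open>metis relcomp.simps\<close>)+

lemma subspace_Domain:
  assumes "linear_relation R"
  shows "complex_vector.subspace (Domain R)"
  by (rule complex_vector.subspaceI)
    (use linear_relationD(1,2,4)[OF assms] in \<open>metis Domain.DomainI Domain.cases\<close>)+

lemma subspace_Range: "linear_relation R \<Longrightarrow> complex_vector.subspace (Range R)"
  using subspace_Domain[OF linear_relation_converse] by (metis Domain_converse)

section \<open>Unitary relations and closedness of their ranges\<close>

lemma closed_unitary_relation:
  assumes "fundamental_symmetry j\<^sub>1" "fundamental_symmetry j\<^sub>2" "has_kind Unitary j\<^sub>1 j\<^sub>2 V"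
  shows "closed V"
  using closed_rel_sharp[OF assms(1,2), of V] assms(3) by simp

lemma unitary_relation_converse:
  assumes "fundamental_symmetry j\<^sub>1" "fundamental_symmetry j\<^sub>2" "has_kind Unitary j\<^sub>1 j\<^sub>2 V"
  shows "has_kind Unitary j\<^sub>2 j\<^sub>1 (V\<inverse>)"
  using assms by (simp add: rel_sharp_converse linear_relation_converse)

lemma unitary_relation_cinner:
  assumes "fundamental_symmetry j\<^sub>1" "has_kind Unitary j\<^sub>1 j\<^sub>2 V" "(x, y) \<in> V" "(u, v) \<in> V"
  shows "cinner (j\<^sub>1 x) u = cinner (j\<^sub>2 y) v"
proof -
  have "(x, y) \<in> rel_sharp j\<^sub>1 j\<^sub>2 V"
    using assms(2,3) by simp
  then show ?thesis
    using assms(4) by (auto simp: rel_sharp_iff[OF assms(1)])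
qed

text \<open>
  Substitute for the closed graph theorem: the vectors \<open>j\<^sub>1 x\<close>, with \<open>(x, y) \<in> V\<close>, \<open>norm y \<le> 1\<close> and \<open>j\<^sub>1 x \<in> Domain V\<close>, are weakly
  bounded because \<open>\<langle>j\<^sub>1 x, u\<rangle> = \<langle>j\<^sub>2 y, v\<rangle>\<close> for \<open>(u, v) \<in> V\<close>.
\<close>
lemma unitary_relation_bounded_below:
  fixes V :: "('a::chilbert_space \<times> 'b::chilbert_space) set"
  assumes j1: "fundamental_symmetry j\<^sub>1" and j2: "fundamental_symmetry j\<^sub>2"
    and V: "has_kind Unitary j\<^sub>1 j\<^sub>2 V" and cl: "closed (Domain V)"
  obtains C where "\<And>x y. (x, y) \<in> V \<Longrightarrow> j\<^sub>1 x \<in> Domain V \<Longrightarrow> norm x \<le> C * norm y"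
proof -
  have lin: "linear_relation V"
    using V by simp
  define F where "F = {j\<^sub>1 x |x y. (x, y) \<in> V \<and> j\<^sub>1 x \<in> Domain V \<and> norm y \<le> 1}"
  have "\<exists>B. \<forall>f\<in>F. cmod (cinner f h) \<le> B" for h
  proof -
    \<comment> \<open>Each \<open>f\<close> in \<open>F\<close> lies in \<open>Domain V\<close> and
      is orthogonal to \<open>h - u\<close>, so \<open>h\<close> may be replaced by
      \<open>u\<close>. Then the Green identity gives a bound through \<open>v\<close>, which does
      not depend on \<open>f\<close>.\<close>
    obtain u where u: "u \<in> Domain V" "\<And>d. d \<in> Domain V \<Longrightarrow> cinner (h - u) d = 0"
      using orthogonal_projection_exists[OF subspace_Domain[OF lin] cl] by blast
    obtain v where v: "(u, v) \<in> V"
      using u(1) by blast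
    have "cmod (cinner f h) \<le> norm v" if fF: "f \<in> F" for f
    proof -
      obtain x y where f: "f = j\<^sub>1 x" "(x, y) \<in> V" "j\<^sub>1 x \<in> Domain V" "norm y \<le> 1"
        using fF by (auto simp: F_def)
      have "cinner f (h - u) = 0"
        using u(2)[OF f(3)] f(1) by (metis cinner_commute complex_cnj_zero)
      then have "cinner f h = cinner (j\<^sub>2 y) v"
        using unitary_relation_cinner[OF j1 V f(2) v] f(1) by (simp add: cinner_diff_right)
      also have "cmod \<dots> \<le> norm y * norm v"
        using cinner_Cauchy_Schwarz[of "j\<^sub>2 y" v] by (simp add: norm_fundamental_symmetry[OF j2])
      also have "\<dots> \<le> norm v"
        using f(4) by (simp add: mult_left_le_one_le)
      finally show ?thesis .
    qed
    then show ?thesis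
      by blast
  qed
  then have "bounded F"
    by (rule weakly_bounded_imp_bounded)
  then obtain C where C: "\<And>f. f \<in> F \<Longrightarrow> norm f \<le> C"
    by (auto simp: bounded_iff)
  have "norm x \<le> C * norm y" if xy: "(x, y) \<in> V" "j\<^sub>1 x \<in> Domain V" for x y
  proof (cases "y = 0")
    case True
    obtain w where "(j\<^sub>1 x, w) \<in> V"
      using xy(2) by blast
    \<comment> \<open>The Green identity for \<open>(x, 0)\<close> and
      \<open>(j\<^sub>1 x, w)\<close>: a kernel element with \<open>j\<^sub>1 x\<close> in the
      domain is zero.\<close>
    then have "cinner (j\<^sub>1 x) (j\<^sub>1 x) = 0"
      using unitary_relation_cinner[OF j1 V xy(1)] True by (simp add: fundamental_symmetryD(5)[OF j2])
    then have "norm (j\<^sub>1 x) = 0"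
      by (simp add: cinner_self_eq_0_iff)
    then show ?thesis
      using True by (simp add: norm_fundamental_symmetry[OF j1])
  next
    case False
    define a where "a = complex_of_real (1 / norm y)"
    have "j\<^sub>1 (a *\<^sub>C x) \<in> F"
      unfolding F_def mem_Collect_eq
    proof (intro exI conjI)
      show "(a *\<^sub>C x, a *\<^sub>C y) \<in> V"
        by (rule linear_relationD(4)[OF lin xy(1)])
      show "j\<^sub>1 (a *\<^sub>C x) \<in> Domain V"
        unfolding fundamental_symmetryD(2)[OF j1]
        by (rule complex_vector.subspace_scale[OF subspace_Domain[OF lin] xy(2)])
      show "norm (a *\<^sub>C y) \<le> 1"
        using False by (simp add: a_def norm_divide)
    qed (rule refl)
    then have "norm (a *\<^sub>C x) \<le> C"
      using C norm_fundamental_symmetry[OF j1] by metis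
    then show ?thesis
      using False by (simp add: a_def norm_divide field_simps)
  qed
  then show thesis
    by (rule that)
qed

text \<open>A convergent sequence in the range is lifted to preimages \<open>x n\<close> with
  \<open>j\<^sub>1 (x n)\<close> in \<open>Domain V\<close>. By the lower bound these form a Cauchy
  sequence, and closedness of \<open>V\<close> puts the limit pair into \<open>V\<close>.\<close>

lemma unitary_relation_closed_Range:
  fixes V :: "('a::chilbert_space \<times> 'b::chilbert_space) set"
  assumes j1: "fundamental_symmetry j\<^sub>1" and j2: "fundamental_symmetry j\<^sub>2"
    and V: "has_kind Unitary j\<^sub>1 j\<^sub>2 V" and cl: "closed (Domain V)"
  shows "closed (Range V)"
  unfolding closed_sequential_limits
proof (intro allI impI, elim conjE)
  fix y l assume y: "\<forall>n. y n \<in> Range V" and lim: "y \<longlonglongrightarrow> l"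
  have lin: "linear_relation V"
    using V by simp
  obtain C where C: "\<And>x y. (x, y) \<in> V \<Longrightarrow> j\<^sub>1 x \<in> Domain V \<Longrightarrow> norm x \<le> C * norm y"
    using unitary_relation_bounded_below[OF assms] by blast
  have "\<exists>x. (x, w) \<in> V \<and> j\<^sub>1 x \<in> Domain V" if w: "w \<in> Range V" for w
  proof -
    obtain x where x: "(x, w) \<in> V"
      using w by blast
    obtain p where p: "p \<in> Domain V" "\<And>d. d \<in> Domain V \<Longrightarrow> cinner (j\<^sub>1 x - p) d = 0"
      using orthogonal_projection_exists[OF subspace_Domain[OF lin] cl] by blast
    \<comment> \<open>The companion of the domain is the kernel of \<open>V = V\<^sub>#\<close>, so
      \<open>x\<close> may be replaced by \<open>j\<^sub>1 p\<close> without changing the image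
      \<open>w\<close>.\<close>
    have "x - j\<^sub>1 p \<in> krein_orthogonal j\<^sub>1 (Domain V)"
      using p(2) by (auto simp: krein_orthogonal_def fundamental_symmetryD(4,7)[OF j1])
    then have "(x - j\<^sub>1 p, 0) \<in> V"
      using V rel_ker_rel_sharp[OF j1 j2, of V] by (auto simp: rel_ker_def)
    then have "(j\<^sub>1 p, w) \<in> V"
      using linear_relationD(3)[OF lin x] by fastforce
    then show ?thesis
      using p(1) by (metis fundamental_symmetryD(4)[OF j1])
  qed
  then have "\<forall>n. \<exists>x. (x, y n) \<in> V \<and> j\<^sub>1 x \<in> Domain V"
    using y by blast
  from choice[OF this] obtain x where x: "\<And>n. (x n, y n) \<in> V" "\<And>n. j\<^sub>1 (x n) \<in> Domain V"
    by blast
  \<comment> \<open>\<open>C\<close> may be zero or negative; \<open>\<bar>C\<bar> + 1\<close> is a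
    positive constant by which \<open>e\<close> can be divided.\<close>
  have diff: "norm (x i - x k) \<le> (\<bar>C\<bar> + 1) * norm (y i - y k)" for i k
  proof -
    have "j\<^sub>1 (x i - x k) \<in> Domain V"
      unfolding fundamental_symmetryD(7)[OF j1]
      by (rule complex_vector.subspace_diff[OF subspace_Domain[OF lin] x(2) x(2)])
    then have "norm (x i - x k) \<le> C * norm (y i - y k)"
      by (rule C[OF linear_relationD(3)[OF lin x(1) x(1)]])
    also have "\<dots> \<le> (\<bar>C\<bar> + 1) * norm (y i - y k)"
      by (intro mult_right_mono) auto
    finally show ?thesis .
  qed
  have "Cauchy x"
  proof (rule metric_CauchyI)
    fix e :: real assume "e > 0"
    then obtain N where N: "\<And>i k. i \<ge> N \<Longrightarrow> k \<ge> N \<Longrightarrow> norm (y i - y k) < e / (\<bar>C\<bar> + 1)"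
      using LIMSEQ_imp_Cauchy[OF lim] by (metis CauchyD abs_add_one_gt_zero add.commute divide_pos_pos)
    have "dist (x i) (x k) < e" if "i \<ge> N" "k \<ge> N" for i k
      using diff[of i k] N[OF that] by (simp add: dist_norm field_simps)
    then show "\<exists>N. \<forall>i\<ge>N. \<forall>k\<ge>N. dist (x i) (x k) < e"
      by blast
  qed
  then obtain p where "x \<longlonglongrightarrow> p"
    using Cauchy_convergent convergent_def by blast
  then have "(\<lambda>n. (x n, y n)) \<longlonglongrightarrow> (p, l)"
    using lim by (rule tendsto_Pair)
  with x(1) have "(p, l) \<in> V"
    by (rule closed_sequentially[OF closed_unitary_relation[OF j1 j2 V]])
  then show "l \<in> Range V"
    by blast
qed

section \<open>Composition with a unitary relation\<close>

lemma rel_sharp_relcomp_subset: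
  fixes V :: "('b::chilbert_space \<times> 'c::chilbert_space) set"
  assumes j1: "fundamental_symmetry j\<^sub>1" and j2: "fundamental_symmetry j\<^sub>2" and j3: "fundamental_symmetry j\<^sub>3"
    and V: "has_kind Unitary j\<^sub>2 j\<^sub>3 V" and cl: "closed (Domain V)"
    and G: "linear_relation \<Gamma>" and dom: "Range \<Gamma> \<subseteq> Domain V"
  shows "rel_sharp j\<^sub>1 j\<^sub>3 (\<Gamma> O V) \<subseteq> rel_sharp j\<^sub>1 j\<^sub>2 \<Gamma> O V"
proof
  fix p assume p: "p \<in> rel_sharp j\<^sub>1 j\<^sub>3 (\<Gamma> O V)"
  obtain x z where xz: "p = (x, z)"
    by fastforce
  have sharp: "cinner (j\<^sub>1 x) u = cinner (j\<^sub>3 z) w" if "(u, v) \<in> \<Gamma>" "(v, w) \<in> V" for u v w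
    using p that by (auto simp: xz rel_sharp_iff[OF j1])
  have lin: "linear_relation V"
    using V by simp
  \<comment> \<open>Elements \<open>(0, w)\<close> of \<open>V\<close> compose with
    \<open>(0, 0)\<close> in \<open>\<Gamma>\<close>, and the Green identity reduces to
    \<open>cinner (j\<^sub>3 z) w = 0\<close>.\<close>
  have "z \<in> krein_orthogonal j\<^sub>3 (rel_mul V)"
    using sharp[OF linear_relationD(1)[OF G]] by (auto simp: krein_orthogonal_def rel_mul_def)
  also have "rel_mul V = krein_orthogonal j\<^sub>3 (Range V)"
    using V rel_mul_rel_sharp[OF j2 j3, of V] by simp
  also have "krein_orthogonal j\<^sub>3 \<dots> = Range V"
    using unitary_relation_closed_Range[OF j2 j3 V cl]
    by (simp add: krein_orthogonal_krein_orthogonal[OF j3 subspace_Range[OF lin]])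
  finally obtain y where y: "(y, z) \<in> V"
    by blast
  have "cinner (j\<^sub>1 x) u = cinner (j\<^sub>2 y) v" if uv: "(u, v) \<in> \<Gamma>" for u v
  proof -
    \<comment> \<open>The inclusion of \<open>Range \<Gamma>\<close> in \<open>Domain V\<close> lets
      every pair of \<open>\<Gamma>\<close> be extended through \<open>V\<close>; the Green
      identities for the composition and for \<open>V\<close> then share the term in
      \<open>z\<close> and \<open>w\<close>.\<close>
    obtain w where w: "(v, w) \<in> V"
      using uv dom by blast
    show ?thesis
      using sharp[OF uv w] unitary_relation_cinner[OF j2 V y w] by simp
  qed
  then have "(x, y) \<in> rel_sharp j\<^sub>1 j\<^sub>2 \<Gamma>"
    by (auto simp: rel_sharp_iff[OF j1])
  then show "p \<in> rel_sharp j\<^sub>1 j\<^sub>2 \<Gamma> O V"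
    unfolding xz using y by (rule relcompI)
qed

text \<open>The Green identities of \<open>\<Gamma>\<close> and \<open>V\<close> chain through the
  intermediate products.\<close>

lemma isometric_relcomp:
  assumes j1: "fundamental_symmetry j\<^sub>1" and j2: "fundamental_symmetry j\<^sub>2"
    and V: "has_kind Unitary j\<^sub>2 j\<^sub>3 V" and G: "has_kind Isometric j\<^sub>1 j\<^sub>2 \<Gamma>"
  shows "has_kind Isometric j\<^sub>1 j\<^sub>3 (\<Gamma> O V)"
proof -
  have "p \<in> rel_sharp j\<^sub>1 j\<^sub>3 (\<Gamma> O V)" if p: "p \<in> \<Gamma> O V" for p
  proof -
    obtain x y z where xyz: "p = (x, z)" "(x, y) \<in> \<Gamma>" "(y, z) \<in> V"
      using p by blast
    have "(x, y) \<in> rel_sharp j\<^sub>1 j\<^sub>2 \<Gamma>"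
      using G xyz(2) by auto
    then have "cinner (j\<^sub>1 x) u = cinner (j\<^sub>2 y) v" if "(u, v) \<in> \<Gamma>" for u v
      using that by (auto simp: rel_sharp_iff[OF j1])
    then show ?thesis
      using unitary_relation_cinner[OF j2 V xyz(3)] by (auto simp: xyz(1) rel_sharp_iff[OF j1])
  qed
  then show ?thesis
    using V G by (auto intro: linear_relation_relcomp)
qed

lemma has_kind_relcomp:
  fixes \<Gamma> :: "('a::chilbert_space \<times> 'b::chilbert_space) set" and V :: "('b \<times> 'c::chilbert_space) set"
  assumes j1: "fundamental_symmetry j\<^sub>1" and j2: "fundamental_symmetry j\<^sub>2" and j3: "fundamental_symmetry j\<^sub>3"
    and V: "has_kind Unitary j\<^sub>2 j\<^sub>3 V" and cl: "closed (Domain V)"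
    and iso: "has_kind Isometric j\<^sub>1 j\<^sub>2 \<Gamma>" and G: "has_kind \<kappa> j\<^sub>1 j\<^sub>2 \<Gamma>" and dom: "Range \<Gamma> \<subseteq> Domain V"
  shows "has_kind \<kappa> j\<^sub>1 j\<^sub>3 (\<Gamma> O V)"
proof -
  have lin: "linear_relation \<Gamma>" "linear_relation (\<Gamma> O V)" and sub: "\<Gamma> O V \<subseteq> rel_sharp j\<^sub>1 j\<^sub>3 (\<Gamma> O V)"
    using iso isometric_relcomp[OF j1 j2 V iso] by auto
  note sharp = rel_sharp_relcomp_subset[OF j1 j2 j3 V cl lin(1) dom]
  show ?thesis
  proof (cases \<kappa>)
    case Isometric
    then show ?thesis
      using lin sub by simp
  next
    case Unitary
    then show ?thesis
      using lin sub sharp G by auto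
  next
    case Essentially_Unitary
    then have clG: "closure \<Gamma> = rel_sharp j\<^sub>1 j\<^sub>2 \<Gamma>"
      using G by simp
    have "closure (\<Gamma> O V) \<subseteq> rel_sharp j\<^sub>1 j\<^sub>3 (\<Gamma> O V)"
      by (rule closure_minimal[OF sub closed_rel_sharp[OF j1 j3]])
    moreover have "rel_sharp j\<^sub>1 j\<^sub>3 (\<Gamma> O V) \<subseteq> rel_sharp j\<^sub>1 j\<^sub>3 (rel_sharp j\<^sub>1 j\<^sub>3 (\<Gamma> O V))"
    proof
      fix p assume "p \<in> rel_sharp j\<^sub>1 j\<^sub>3 (\<Gamma> O V)"
      then obtain x y z where p: "p = (x, z)" "(x, y) \<in> rel_sharp j\<^sub>1 j\<^sub>2 \<Gamma>" "(y, z) \<in> V"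
        using sharp by blast
      \<comment> \<open>Both \<open>\<Gamma>\<^sub>#\<close> and
        \<open>\<Gamma>\<^sub>#\<^sub>#\<close> equal \<open>closure \<Gamma>\<close>, so the
        companion of \<open>\<Gamma>\<close> is itself isometric. Chaining with \<open>V\<close>
        carries this over to the composition.\<close>
      have "(x, y) \<in> rel_sharp j\<^sub>1 j\<^sub>2 (rel_sharp j\<^sub>1 j\<^sub>2 \<Gamma>)"
        using p(2) clG rel_sharp_rel_sharp[OF j1 j2 lin(1)] by simp
      then have xy: "cinner (j\<^sub>1 x) u = cinner (j\<^sub>2 y) v" if "(u, v) \<in> rel_sharp j\<^sub>1 j\<^sub>2 \<Gamma>" for u v
        using that by (auto simp: rel_sharp_iff[OF j1, of x])
      have "cinner (j\<^sub>1 x) u = cinner (j\<^sub>3 z) w" if uw: "(u, w) \<in> rel_sharp j\<^sub>1 j\<^sub>3 (\<Gamma> O V)" for u w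
      proof -
        obtain v where "(u, v) \<in> rel_sharp j\<^sub>1 j\<^sub>2 \<Gamma>" "(v, w) \<in> V"
          using uw sharp by blast
        then show ?thesis
          using xy unitary_relation_cinner[OF j2 V p(3)] by metis
      qed
      then show "p \<in> rel_sharp j\<^sub>1 j\<^sub>3 (rel_sharp j\<^sub>1 j\<^sub>3 (\<Gamma> O V))"
        unfolding p(1) rel_sharp_iff[OF j1, of x] by blast
    qed
    ultimately show ?thesis
      using Essentially_Unitary lin(2) rel_sharp_rel_sharp[OF j1 j3 lin(2)] by auto
  qed
qed

text \<open>The kernel of the companion depends on the domain only, and
  \<open>Range \<Gamma> \<subseteq> Domain V\<close> makes the domains of \<open>\<Gamma>\<close>
  and \<open>\<Gamma> O V\<close> equal, so \<open>T\<close> is unchanged.\<close>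

lemma boundary_pair_relcomp:
  fixes J :: "'h::chilbert_space \<Rightarrow> 'h"
    and V :: "(('l::chilbert_space \<times> 'l) \<times> ('k::chilbert_space \<times> 'k)) set"
  assumes J: "fundamental_symmetry J" and V: "has_kind Unitary (square_symmetry id) (square_symmetry id) V"
    and cl: "closed (Domain V)" and G: "boundary_pair \<kappa> J T \<Gamma>" and dom: "Range \<Gamma> \<subseteq> Domain V"
  shows "boundary_pair \<kappa> J T (\<Gamma> O V)"
proof -
  note j = fundamental_symmetry_square[OF J] fundamental_symmetry_square[OF fundamental_symmetry_id]
    fundamental_symmetry_square[OF fundamental_symmetry_id]
  have "Domain (\<Gamma> O V) = Domain \<Gamma>"
    using dom by blast
  then show ?thesis
    using G has_kind_relcomp[OF j V cl _ _ dom] unfolding boundary_pair_def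
    by (simp add: rel_ker_rel_sharp j del: has_kind.simps)
qed

text \<open>Going through \<open>V\<close> and back can change \<open>y\<close> only by an element
  of \<open>rel_ker V\<close>, and \<open>\<Gamma>\<close> absorbs such changes when they lie in
  \<open>rel_mul \<Gamma>\<close>.\<close>

lemma relcomp_converse_cancel:
  assumes G: "linear_relation \<Gamma>" and V: "linear_relation V"
    and dom: "Range \<Gamma> \<subseteq> Domain V" and ker: "rel_ker V \<subseteq> rel_mul \<Gamma>"
  shows "(\<Gamma> O V) O V\<inverse> = \<Gamma>"
proof
  show "\<Gamma> \<subseteq> (\<Gamma> O V) O V\<inverse>"
  proof (rule subrelI)
    fix x y assume xy: "(x, y) \<in> \<Gamma>"
    then obtain z where "(y, z) \<in> V"
      using dom by blast
    with xy show "(x, y) \<in> (\<Gamma> O V) O V\<inverse>"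
      by blast
  qed
  show "(\<Gamma> O V) O V\<inverse> \<subseteq> \<Gamma>"
  proof
    fix p assume "p \<in> (\<Gamma> O V) O V\<inverse>"
    then obtain x y y' z where p: "p = (x, y')" "(x, y) \<in> \<Gamma>" "(y, z) \<in> V" "(y', z) \<in> V"
      by blast
    have "(0, y - y') \<in> \<Gamma>"
      using linear_relationD(3)[OF V p(3,4)] ker by (auto simp: rel_ker_def rel_mul_def)
    then show "p \<in> \<Gamma>"
      using linear_relationD(3)[OF G p(2)] p(1) by fastforce
  qed
qed

theorem theorem7p3:
  fixes J :: "'h::chilbert_space \<Rightarrow> 'h"
    and T :: "('h \<times> 'h) set"
    and V :: "(('l::chilbert_space \<times> 'l) \<times> ('k::chilbert_space \<times> 'k)) set"
    and \<kappa> :: relation_kind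
  assumes "fundamental_symmetry J"
    and "closed T" and "symmetric_relation J T"
    and "has_kind Unitary (square_symmetry id) (square_symmetry id) V"
    and "closed (Domain V)"
  shows
    "(\<forall>\<Gamma>. boundary_pair \<kappa> J T \<Gamma> \<and> Range \<Gamma> \<subseteq> Domain V \<longrightarrow>
        boundary_pair \<kappa> J T (\<Gamma> O V) \<and>
        (\<forall>z. z \<notin> \<real> \<longrightarrow> weyl_family (\<Gamma> O V) z = V `` weyl_family \<Gamma> z)) \<and>
     bij_betw (\<lambda>\<Gamma>. \<Gamma> O V)
       {\<Gamma>. boundary_pair \<kappa> J T \<Gamma> \<and> Range \<Gamma> \<subseteq> Domain V \<and> rel_ker V \<subseteq> rel_mul \<Gamma>}
       {\<Gamma>'. boundary_pair \<kappa> J T \<Gamma>' \<and> Range \<Gamma>' \<subseteq> Range V \<and> rel_mul V \<subseteq> rel_mul \<Gamma>'}"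
proof -
  note j = fundamental_symmetry_square[OF fundamental_symmetry_id]
  \<comment> \<open>Closedness of the range gives \<open>V\<inverse>\<close> the same properties as
    \<open>V\<close>, so the forward result also applies to it.\<close>
  have cl': "closed (Domain (V\<inverse>))"
    using unitary_relation_closed_Range[OF j j assms(4,5)] by simp
  have V': "has_kind Unitary (square_symmetry id) (square_symmetry id) (V\<inverse>)"
    by (rule unitary_relation_converse[OF j j assms(4)])
  have V: "linear_relation V"
    using assms(4) by simp
  \<comment> \<open>The type \<open>'m\<close> stays general so that the fact serves pairs over
    \<open>'l\<close> and over \<open>'k\<close>.\<close>
  have lin: "linear_relation \<Gamma>" if "boundary_pair \<kappa> J T \<Gamma>"
    for \<Gamma> :: "(('h \<times> 'h) \<times> ('m::chilbert_space \<times> 'm)) set"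
    using that by (simp add: boundary_pair_def)
  have weyl: "weyl_family (\<Gamma> O V) z = V `` weyl_family \<Gamma> z"
    for \<Gamma> :: "(('h \<times> 'h) \<times> ('l \<times> 'l)) set" and z
    by (auto simp: weyl_family_def)
  let ?A = "{\<Gamma>. boundary_pair \<kappa> J T \<Gamma> \<and> Range \<Gamma> \<subseteq> Domain V \<and> rel_ker V \<subseteq> rel_mul \<Gamma>}"
  let ?B = "{\<Gamma>'. boundary_pair \<kappa> J T \<Gamma>' \<and> Range \<Gamma>' \<subseteq> Range V \<and> rel_mul V \<subseteq> rel_mul \<Gamma>'}"
  have "bij_betw (\<lambda>\<Gamma>. \<Gamma> O V) ?A ?B"
  proof (rule bij_betwI[where g = "\<lambda>\<Gamma>'. \<Gamma>' O V\<inverse>"])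
    show "(\<lambda>\<Gamma>. \<Gamma> O V) \<in> ?A \<rightarrow> ?B"
    proof (intro Pi_I CollectI conjI; clarify)
      fix \<Gamma> :: "(('h \<times> 'h) \<times> ('l \<times> 'l)) set"
      assume G: "boundary_pair \<kappa> J T \<Gamma>" "Range \<Gamma> \<subseteq> Domain V"
      show "boundary_pair \<kappa> J T (\<Gamma> O V)"
        by (rule boundary_pair_relcomp[OF assms(1,4,5) G])
      \<comment> \<open>As \<open>(0, 0)\<close> is in \<open>\<Gamma>\<close>, each
        \<open>(0, x)\<close> in \<open>V\<close> survives in the composition; hence the condition
        on \<open>rel_mul \<Gamma>'\<close> in the target set.\<close>
      show "x \<in> rel_mul (\<Gamma> O V)" if "x \<in> rel_mul V" for x
        using that linear_relationD(1)[OF lin[OF G(1)]]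
        by (auto simp: rel_mul_def zero_prod_def intro: relcompI)
    qed blast
    show "(\<lambda>\<Gamma>'. \<Gamma>' O V\<inverse>) \<in> ?B \<rightarrow> ?A"
    proof (intro Pi_I CollectI conjI; clarify)
      fix \<Gamma>' :: "(('h \<times> 'h) \<times> ('k \<times> 'k)) set"
      assume G: "boundary_pair \<kappa> J T \<Gamma>'" "Range \<Gamma>' \<subseteq> Range V"
      show "boundary_pair \<kappa> J T (\<Gamma>' O V\<inverse>)"
        by (rule boundary_pair_relcomp[OF assms(1) V' cl' G(1)]) (use G(2) in simp)
      show "x \<in> rel_mul (\<Gamma>' O V\<inverse>)" if "x \<in> rel_ker V" for x
        using that linear_relationD(1)[OF lin[OF G(1)]]
        by (auto simp: rel_mul_def rel_ker_def zero_prod_def intro: relcompI)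
    qed blast
    show "(\<Gamma> O V) O V\<inverse> = \<Gamma>" if "\<Gamma> \<in> ?A" for \<Gamma>
      using that by (intro relcomp_converse_cancel V lin) auto
    show "(\<Gamma>' O V\<inverse>) O V = \<Gamma>'" if "\<Gamma>' \<in> ?B" for \<Gamma>'
    proof -
      \<comment> \<open>The cancellation lemma is applied to \<open>V\<inverse>\<close>, which turns
        its kernel condition into the one defining \<open>?B\<close>.\<close>
      have "rel_ker (V\<inverse>) = rel_mul V"
        by (simp add: rel_ker_def rel_mul_def)
      then have "(\<Gamma>' O V\<inverse>) O (V\<inverse>)\<inverse> = \<Gamma>'"
        using that by (intro relcomp_converse_cancel linear_relation_converse V lin) auto
      then show ?thesis
        by simp
    qed
  qed
  then show ?thesis
    using boundary_pair_relcomp[OF assms(1,4,5)] weyl by blast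
qed

end
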